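(* Let $G=\mathbb{R}^{2n}\times\mathbb{R}^m$ be an H-type group, and let $x(1)\in\mathbb{R}^{2n}$, $z(1)\in\mathbb{R}^m$ be given. A path $t\mapsto(x(t),z(t))$, $t\in[0,1]$, in $G$ is the projection to $G$ of a solution $(x(t),z(t),\xi(t),\eta(t))$ of Hamilton's equations for the subriemannian Hamiltonian with $x(0)=0$, $z(0)=0$ and with the given endpoint $(x(1),z(1))$ if and only if: 1. If $z(1)=0$: $x(t)=t\,x(1)$ and $z(t)=0$ for all $t$. 2. If $z(1)\neq0$: $$x(t)=\frac{1}{|\eta_0|^2}J_{\eta_0}(I-e^{tJ_{\eta_0}})\xi_0,\qquad z(t)=\frac{|\xi_0|^2}{2|\eta_0|^3}\bigl(|\eta_0|t-\sin(|\eta_0|t)\bigr)\eta_0,$$ where, if $x(1)\neq0$, $$\eta_0=2\theta\frac{z(1)}{|z(1)|},\qquad \xi_0=-|\eta_0|^2\bigl(J_{\eta_0}(e^{J_{\eta_0}}-I)\bigr)^{-1}x(1),$$ with $\theta$ a solution of $\nu(\theta)=\dfrac{4|z(1)|}{|x(1)|^2}$; and, if $x(1)=0$, $$\eta_0=2\pi k\frac{z(1)}{|z(1)|},\qquad |\xi_0|=\sqrt{4k\pi|z(1)|}$$ for some integer $k\ge1$ (where $\xi_0\in\mathbb{R}^{2n}$ may be any vector of this length).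
   Context: H-type groups: a finite-dimensional real Lie algebra $\mathfrak g$ with center $\mathfrak z\neq0$ is of H-type if it carries an inner product such that $[\mathfrak z^\perp,\mathfrak z^\perp]=\mathfrak z$ and, for each $z\in\mathfrak z$, the linear map $J_z:\mathfrak z^\perp\to\mathfrak z^\perp$ defined by $\langle J_zx,y\rangle=\langle z,[x,y]\rangle$ is orthogonal whenever $\langle z,z\rangle=1$. An H-type group is a connected simply connected Lie group with such a Lie algebra. Write $\dim\mathfrak z^\perp=2n$, $\dim\mathfrak z=m$. One realizes $G$ as $\mathbb{R}^{2n}\times\mathbb{R}^m$ with points $(x,z)$, where $\mathfrak z^\perp=\mathbb{R}^{2n}$, $\mathfrak z=\mathbb{R}^m$ carry the Euclidean inner product, $[\cdot,\cdot]:\mathbb{R}^{2n}\times\mathbb{R}^{2n}\to\mathbb{R}^m$ is the bracket, and the group law is $(x,z)\circ(x',z')=(x+x',\,z+z'+\tfrac12[x,x'])$. With $e_i$, $u_j$ the standard bases of $\mathbb{R}^{2n}$, $\mathbb{R}^m$, let $X_i=\frac{\partial}{\partial x^i}+\frac12\sum_j\langle J_{u_j}x,e_i\rangle\frac{\partial}{\partial z^j}$, $i=1,\dots,2n$. Coordinates $(x,z,\xi,\eta)\in\mathbb{R}^{2n}\times\mathbb{R}^m\times\mathbb{R}^{2n}\times\mathbb{R}^m$ on $T^*G$: the covector is $\sum_i\xi_idx^i+\sum_j\eta_jdz^j$ at $(x,z)$. The subriemannian Hamiltonian is $H(p_g)=\frac12\sum_{i=1}^{2n}p_g(X_i(g))^2$,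 i.e. $H=\frac12|\xi+\frac12J_\eta x|^2$. Hamilton's equations are $\dot x=\nabla_\xi H$, $\dot z=\nabla_\eta H$, $\dot\xi=-\nabla_xH$, $\dot\eta=-\nabla_zH$. The function $\nu$ is $\nu(\theta)=\frac{2\theta-\sin2\theta}{1-\cos2\theta}=\frac{\theta}{\sin^2\theta}-\cot\theta$ for $\theta\in\mathbb{R}\setminus\pi\mathbb{Z}$, with $\nu(0)=0$. *)

theory Defs
  imports "HOL-Analysis.Analysis"
begin

section \<open>H-type Lie algebras\<close>

definition lie_algebra :: "('a::real_vector \<Rightarrow> 'a \<Rightarrow> 'a) \<Rightarrow> bool" where
  "lie_algebra B \<longleftrightarrow> bilinear B \<and> (\<forall>x. B x x = 0) \<and>
     (\<forall>x y w. B x (B y w) + B y (B w x) + B w (B x y) = 0)"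

definition lie_center :: "('a::real_vector \<Rightarrow> 'a \<Rightarrow> 'a) \<Rightarrow> 'a set" where
  "lie_center B = {z. \<forall>x. B z x = 0}"

text \<open>
  \<open>J_map V b z x\<close> is the vector \<open>J\<^sub>z x \<in> V\<close> determined by
  \<open>\<langle>J\<^sub>z x, y\<rangle> = \<langle>z, [x, y]\<rangle>\<close> for all \<open>y \<in> V\<close>, where \<open>V\<close> is a subspace. It is used with \<open>V\<close> the
  orthogonal complement of the center of a Lie algebra, and with \<open>V = UNIV\<close> when that
  complement has been identified with \<open>\<real>\<^sup>2\<^sup>n\<close>.
\<close>

definition J_map ::
    "'a set \<Rightarrow> ('a::euclidean_space \<Rightarrow> 'a \<Rightarrow> 'b::euclidean_space) \<Rightarrow> 'b \<Rightarrow> 'a \<Rightarrow> 'a" where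
  "J_map V b z x = (THE w. w \<in> V \<and> (\<forall>y\<in>V. w \<bullet> y = z \<bullet> b x y))"

text \<open>
  The inner product of the definition is the one of the ambient Euclidean space.
  \<open>[\<zz>\<^sup>\<bottom>, \<zz>\<^sup>\<bottom>]\<close> is the linear span of the brackets.
\<close>

definition h_type_algebra :: "('a::euclidean_space \<Rightarrow> 'a \<Rightarrow> 'a) \<Rightarrow> bool" where
  "h_type_algebra B \<longleftrightarrow>
     lie_algebra B \<and>
     lie_center B \<noteq> {0} \<and>
     span {B x y | x y. x \<in> (lie_center B)\<^sup>\<bottom> \<and> y \<in> (lie_center B)\<^sup>\<bottom>} = lie_center B \<and>
     (\<forall>z\<in>lie_center B. z \<bullet> z = 1 \<longrightarrow>
        (\<forall>x\<in>(lie_center B)\<^sup>\<bottom>. \<forall>y\<in>(lie_center B)\<^sup>\<bottom>.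
           J_map ((lie_center B)\<^sup>\<bottom>) B z x \<bullet> J_map ((lie_center B)\<^sup>\<bottom>) B z y = x \<bullet> y))"

section \<open>H-type groups realized on \<open>\<real>\<^sup>2\<^sup>n \<times> \<real>\<^sup>m\<close>\<close>

text \<open>
  The group is given by a bracket \<open>br\<close> from \<open>\<real>\<^sup>2\<^sup>n \<times> \<real>\<^sup>2\<^sup>n\<close> to \<open>\<real>\<^sup>m\<close>; its Lie algebra is the space
  \<open>\<real>\<^sup>2\<^sup>n \<times> \<real>\<^sup>m\<close> with the Euclidean inner product and the extension of \<open>br\<close> by zero.
\<close>

definition full_bracket ::
    "('a::real_vector \<Rightarrow> 'a \<Rightarrow> 'b::real_vector) \<Rightarrow> 'a \<times> 'b \<Rightarrow> 'a \<times> 'b \<Rightarrow> 'a \<times> 'b" where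
  "full_bracket br g h = (0, br (fst g) (fst h))"

definition h_type_group :: "(real^'d \<Rightarrow> real^'d \<Rightarrow> real^'m) \<Rightarrow> bool" where
  "h_type_group br \<longleftrightarrow>
     h_type_algebra (full_bracket br) \<and> lie_center (full_bracket br) = {0} \<times> UNIV"

definition group_mult ::
    "(real^'d \<Rightarrow> real^'d \<Rightarrow> real^'m) \<Rightarrow>
     (real^'d) \<times> (real^'m) \<Rightarrow> (real^'d) \<times> (real^'m) \<Rightarrow> (real^'d) \<times> (real^'m)" where
  "group_mult br g h = (fst g + fst h, snd g + snd h + (1/2) *\<^sub>R br (fst g) (fst h))"

abbreviation J :: "(real^'d \<Rightarrow> real^'d \<Rightarrow> real^'m) \<Rightarrow> real^'m \<Rightarrow> real^'d \<Rightarrow> real^'d" where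
  "J br \<equiv> J_map UNIV br"

definition X_field ::
    "(real^'d \<Rightarrow> real^'d \<Rightarrow> real^'m) \<Rightarrow> 'd \<Rightarrow> (real^'d) \<times> (real^'m) \<Rightarrow> (real^'d) \<times> (real^'m)" where
  "X_field br i g = (axis i 1, \<Sum>j\<in>UNIV. ((1/2) * (J br (axis j 1) (fst g) \<bullet> axis i 1)) *\<^sub>R axis j 1)"

text \<open>The covector \<open>(\<xi>, \<eta>)\<close> at \<open>(x, z)\<close> acts on tangent vectors through the Euclidean inner product.\<close>

definition hamiltonian ::
    "(real^'d \<Rightarrow> real^'d \<Rightarrow> real^'m) \<Rightarrow> real^'d \<Rightarrow> real^'m \<Rightarrow> real^'d \<Rightarrow> real^'m \<Rightarrow> real" where
  "hamiltonian br x z \<xi> \<eta> = (1/2) * (\<Sum>i\<in>UNIV. ((\<xi>, \<eta>) \<bullet> X_field br i (x, z))\<^sup>2)"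

text \<open>At the endpoints of \<open>[0, 1]\<close> the time derivatives are one-sided.\<close>

definition hamilton_solution ::
    "('a::real_inner \<Rightarrow> 'b::real_inner \<Rightarrow> 'a \<Rightarrow> 'b \<Rightarrow> real) \<Rightarrow>
     (real \<Rightarrow> 'a) \<Rightarrow> (real \<Rightarrow> 'b) \<Rightarrow> (real \<Rightarrow> 'a) \<Rightarrow> (real \<Rightarrow> 'b) \<Rightarrow> bool" where
  "hamilton_solution H x z \<xi> \<eta> \<longleftrightarrow>
     (\<forall>t\<in>{0..1}. \<exists>x' z' \<xi>' \<eta>'.
        (x has_vector_derivative x') (at t within {0..1}) \<and>
        (z has_vector_derivative z') (at t within {0..1}) \<and>
        (\<xi> has_vector_derivative \<xi>') (at t within {0..1}) \<and>
        (\<eta> has_vector_derivative \<eta>') (at t within {0..1}) \<and>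
        GDERIV (\<lambda>p. H (x t) (z t) p (\<eta> t)) (\<xi> t) :> x' \<and>
        GDERIV (\<lambda>q. H (x t) (z t) (\<xi> t) q) (\<eta> t) :> z' \<and>
        GDERIV (\<lambda>y. H y (z t) (\<xi> t) (\<eta> t)) (x t) :> (- \<xi>') \<and>
        GDERIV (\<lambda>w. H (x t) w (\<xi> t) (\<eta> t)) (z t) :> (- \<eta>'))"

section \<open>The operator exponential and the function \<open>\<nu>\<close>\<close>

definition op_exp :: "('a::real_normed_vector \<Rightarrow> 'a) \<Rightarrow> 'a \<Rightarrow> 'a" where
  "op_exp A v = (\<Sum>k. (1 / fact k) *\<^sub>R (A ^^ k) v)"

definition nu_domain :: "real set" where
  "nu_domain = insert 0 (UNIV - {of_int k * pi | k::int. True})"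

definition nu :: "real \<Rightarrow> real" where
  "nu \<theta> = (if \<theta> = 0 then 0 else (2 * \<theta> - sin (2 * \<theta>)) / (1 - cos (2 * \<theta>)))"

section \<open>Basic facts\<close>

lemma J_inner:
  fixes br :: "real^'d \<Rightarrow> real^'d \<Rightarrow> real^'m"
  assumes "bilinear br"
  shows "J br z x \<bullet> y = z \<bullet> br x y"
proof -
  let ?w = "adjoint (br x) z"
  have lin: "linear (br x)"
    using assms by (simp add: bilinear_def)
  have w: "?w \<bullet> y = z \<bullet> br x y" for y
    using adjoint_clauses(2)[OF lin] by blast
  have "J br z x = ?w"
    unfolding J_map_def
  proof (rule the_equality)
    fix u assume "u \<in> UNIV \<and> (\<forall>y\<in>UNIV. u \<bullet> y = z \<bullet> br x y)"
    then have "\<forall>y. u \<bullet> y = ?w \<bullet> y"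
      by (simp add: w)
    then show "u = ?w"
      by (metis vector_eq_rdot)
  qed (simp add: w)
  then show ?thesis
    by (simp add: w)
qed

lemma h_type_group_bilinear:
  assumes "h_type_group br"
  shows "bilinear br"
proof -
  have "bilinear (full_bracket br)"
    using assms by (simp add: h_type_group_def h_type_algebra_def lie_algebra_def)
  then have 1: "linear (full_bracket br (x, 0))" and 2: "linear (\<lambda>g. full_bracket br g (x, 0))" for x
    by (simp_all add: bilinear_def)
  have i: "linear (\<lambda>y :: real^'a. (y, 0 :: real^'b))"
    by (rule linearI) auto
  have "br x = snd \<circ> full_bracket br (x, 0) \<circ> (\<lambda>y. (y, 0))" for x
    by (auto simp: full_bracket_def)
  moreover have "(\<lambda>y. br y x) = snd \<circ> (\<lambda>g. full_bracket br g (x, 0)) \<circ> (\<lambda>y. (y, 0))" for x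
    by (auto simp: full_bracket_def)
  ultimately show ?thesis
    unfolding bilinear_def
    by (metis 1 2 i linear_compose linear_snd)
qed

text \<open>The fields \<open>X_field br i\<close> are the left-invariant extensions of the standard basis of \<open>\<real>\<^sup>2\<^sup>n\<close>.\<close>

lemma X_field_eq:
  assumes "bilinear br"
  shows "X_field br i g = (axis i 1, (1/2) *\<^sub>R br (fst g) (axis i 1))"
proof -
  have "(\<Sum>j\<in>UNIV. ((1/2) * (J br (axis j 1) (fst g) \<bullet> axis i 1)) *\<^sub>R axis j 1)
      = (\<Sum>j\<in>UNIV. ((1/2) *\<^sub>R br (fst g) (axis i 1)) $ j *s axis j 1)"
    by (simp add: J_inner[OF assms] inner_axis' scalar_mult_eq_scaleR)
  then show ?thesis
    unfolding X_field_def basis_expansion by simp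
qed

lemma X_field_left_invariant:
  assumes "bilinear br"
  shows "((\<lambda>s. group_mult br g (s *\<^sub>R axis i 1, 0)) has_vector_derivative X_field br i g) (at 0)"
proof -
  have lin: "linear (br (fst g))"
    using assms by (simp add: bilinear_def)
  have "group_mult br g (s *\<^sub>R axis i 1, 0) = g + s *\<^sub>R X_field br i g" for s
    by (simp add: group_mult_def X_field_eq[OF assms] prod_eq_iff linear_cmul[OF lin])
  then show ?thesis
    by (auto intro!: derivative_eq_intros)
qed

lemma hamiltonian_eq:
  assumes "bilinear br"
  shows "hamiltonian br x z \<xi> \<eta> = (1/2) * (norm (\<xi> + (1/2) *\<^sub>R J br \<eta> x))\<^sup>2"
proof -
  have "(\<xi>, \<eta>) \<bullet> X_field br i (x, z) = (\<xi> + (1/2) *\<^sub>R J br \<eta> x) $ i" for i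
  proof -
    have "J br \<eta> x $ i = J br \<eta> x \<bullet> axis i 1"
      by (simp add: inner_axis)
    also have "\<dots> = \<eta> \<bullet> br x (axis i 1)"
      by (rule J_inner[OF assms])
    finally show ?thesis
      by (simp add: X_field_eq[OF assms] inner_axis)
  qed
  then show ?thesis
    unfolding hamiltonian_def power2_norm_eq_inner
    by (simp add: inner_vec_def power2_eq_square)
qed

end

theory Submission
  imports Defs
begin

text \<open>
  Along a solution, \<open>\<eta>\<close> is constant and the velocity \<open>p = \<xi> + (1/2) J\<^sub>\<eta> x\<close> satisfies \<open>p' = J\<^sub>\<eta> p\<close>, so that
  \<open>p(t)\<close> is the rotation \<open>cos(at) \<xi>\<^sub>0 + (sin(at) / a) J\<^sub>\<eta> \<xi>\<^sub>0\<close> with \<open>a = |\<eta>|\<close>, because \<open>J\<^sub>\<eta>\<^sup>2 = -a\<^sup>2\<close>.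
  Integrating \<open>x' = p\<close> and \<open>z' = [x, p] / 2\<close> with \<open>[x, J\<^sub>\<eta> x] = |x|\<^sup>2 \<eta>\<close> gives all solutions from the origin
  in closed form. At time 1 they satisfy \<open>|x|\<^sup>2 = 2 (1 - cos a) |\<xi>\<^sub>0|\<^sup>2 / a\<^sup>2\<close> and
  \<open>|z| = (a - sin a) |\<xi>\<^sub>0|\<^sup>2 / (2 a\<^sup>2)\<close>, where \<open>z\<close> is a nonnegative multiple of \<open>\<eta>\<close>; hence
  \<open>|z| / |x|\<^sup>2 = \<nu>(a/2) / 4\<close>, unless \<open>cos a = 1\<close>, in which case \<open>x(1) = 0\<close>.
\<close>

section \<open>Analytic preliminaries: operator exponential, uniqueness of solutions,
  gradients\<close>

text \<open>Since \<open>A\<close> squares to a negative scalar, even powers act as scalars and odd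
  powers as multiples of \<open>A\<close>; the exponential series splits into a cosine series on
  \<open>v\<close> and a sine series on \<open>A v\<close>.\<close>

lemma op_exp_rotation:
  fixes A :: "'a::real_normed_vector \<Rightarrow> 'a"
  assumes "linear A" and sq: "\<And>v. A (A v) = - (a\<^sup>2 *\<^sub>R v)" and "a \<noteq> 0"
  shows "op_exp (\<lambda>v. t *\<^sub>R A v) v = cos (a * t) *\<^sub>R v + (sin (a * t) / a) *\<^sub>R A v"
proof -
  have pow: "((\<lambda>v. t *\<^sub>R A v) ^^ k) v =
      (if even k then ((-1) ^ (k div 2) * (a * t) ^ k) *\<^sub>R v
       else ((-1) ^ ((k - 1) div 2) * (a * t) ^ k / a) *\<^sub>R A v)" for k
  proof (induction k)
    case (Suc k)
    show ?case
    proof (cases "even k")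
      case True
      then show ?thesis
        using Suc \<open>a \<noteq> 0\<close> by (simp add: linear_cmul[OF \<open>linear A\<close>] mult_ac)
    next
      case False
      then have "Suc k div 2 = Suc ((k - 1) div 2)"
        by presburger
      then show ?thesis
        using False Suc \<open>a \<noteq> 0\<close>
        by (simp add: linear_cmul[OF \<open>linear A\<close>] sq power2_eq_square mult_ac)
    qed
  qed simp
  have "(1 / fact k) *\<^sub>R ((\<lambda>v. t *\<^sub>R A v) ^^ k) v =
      (cos_coeff k *\<^sub>R (a * t) ^ k) *\<^sub>R v + (sin_coeff k *\<^sub>R (a * t) ^ k / a) *\<^sub>R A v" for k
    by (simp add: pow cos_coeff_def sin_coeff_def)
  moreover have "(\<lambda>k. (cos_coeff k *\<^sub>R (a * t) ^ k) *\<^sub>R v + (sin_coeff k *\<^sub>R (a * t) ^ k / a) *\<^sub>R A v)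
      sums (cos (a * t) *\<^sub>R v + (sin (a * t) / a) *\<^sub>R A v)"
    by (intro sums_add bounded_linear.sums[OF bounded_linear_scaleR_left] sums_divide
        cos_converges sin_converges)
  ultimately show ?thesis
    unfolding op_exp_def by (simp add: sums_iff)
qed

text \<open>Skewness of \<open>A\<close> makes the distance of two solutions constant.\<close>

lemma skew_ode_unique:
  fixes f g :: "real \<Rightarrow> 'a::euclidean_space"
  assumes "linear A" and skew: "\<And>v. A v \<bullet> v = 0" and "convex S" and "s \<in> S" "f s = g s"
    and f: "\<And>t. t \<in> S \<Longrightarrow> (f has_vector_derivative A (f t)) (at t within S)"
    and g: "\<And>t. t \<in> S \<Longrightarrow> (g has_vector_derivative A (g t)) (at t within S)"
    and "t \<in> S"
  shows "f t = g t"
proof -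
  define d where "d t = f t - g t" for t
  have "((\<lambda>t. d t \<bullet> d t) has_derivative (\<lambda>h. 0)) (at t within S)" if "t \<in> S" for t
  proof -
    have "(d has_derivative (\<lambda>h. h *\<^sub>R A (d t))) (at t within S)"
      unfolding d_def linear_diff[OF \<open>linear A\<close>] has_vector_derivative_def[symmetric]
      by (intro has_vector_derivative_diff f g that)
    from has_derivative_inner[OF this this] show ?thesis
      by (simp add: skew inner_commute[of "d t"])
  qed
  from has_derivative_zero_unique[OF \<open>convex S\<close> this \<open>s \<in> S\<close> \<open>t \<in> S\<close>]
  show ?thesis
    using \<open>f s = g s\<close> by (simp add: d_def)
qed

lemma vector_derivative_eq_unique:
  fixes f g :: "real \<Rightarrow> 'a::euclidean_space"
  assumes "convex S" "s \<in> S" "f s = g s"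
    and f: "\<And>t. t \<in> S \<Longrightarrow> (f has_vector_derivative D t) (at t within S)"
    and g: "\<And>t. t \<in> S \<Longrightarrow> (g has_vector_derivative D t) (at t within S)"
    and "t \<in> S"
  shows "f t = g t"
proof -
  have "((\<lambda>t. f t - g t) has_derivative (\<lambda>h. 0)) (at t within S)" if "t \<in> S" for t
    using has_vector_derivative_diff[OF f g, OF that that]
    by (simp add: has_vector_derivative_def)
  from has_derivative_zero_unique[OF \<open>convex S\<close> this \<open>s \<in> S\<close> \<open>t \<in> S\<close>]
  show ?thesis
    using \<open>f s = g s\<close> by simp
qed

text \<open>Chain rule: \<open>D\<close> is the adjoint of \<open>L\<close> applied to
  \<open>c + L v\<close>, described by its inner products. The Hamiltonian has this shape in each of
  \<open>x\<close>, \<open>\<xi>\<close> and \<open>\<eta>\<close> separately.\<close>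

lemma GDERIV_half_norm_sq:
  fixes L :: "'a::euclidean_space \<Rightarrow> 'b::euclidean_space"
  assumes "linear L" and D: "\<And>h. D \<bullet> h = (c + L v) \<bullet> L h"
  shows "GDERIV (\<lambda>v. (1/2) * (norm (c + L v))\<^sup>2) v :> D"
proof -
  have "(L has_derivative L) (at v)"
    using \<open>linear L\<close> by (simp add: linear_imp_has_derivative)
  then show ?thesis
    unfolding gderiv_def power2_norm_eq_inner
    by (auto intro!: derivative_eq_intros simp: D inner_commute[of _ D] inner_commute[of "L _"])
qed

lemma GDERIV_unique:
  assumes "GDERIV f x :> D" "GDERIV f x :> E"
  shows "D = E"
proof -
  have "(\<lambda>h. h \<bullet> D) = (\<lambda>h. h \<bullet> E)"
    using assms unfolding gderiv_def by (rule has_derivative_unique)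
  then show ?thesis
    by (metis vector_eq_ldot)
qed

section \<open>Algebra of the maps J and of the bracket in an H-type group\<close>

lemma bilinear_J:
  assumes "bilinear br"
  shows "bilinear (J br)"
  unfolding bilinear_def
proof (intro conjI allI linearI)
  fix u v w :: "real^'b" and x y :: "real^'a" and r :: real
  note s = J_inner[OF assms] inner_add_left bilinear_ladd[OF assms] bilinear_lmul[OF assms]
    inner_add_right
  have "\<forall>e. J br (u + v) x \<bullet> e = (J br u x + J br v x) \<bullet> e"
    by (simp add: s)
  then show "J br (u + v) x = J br u x + J br v x" by (metis vector_eq_rdot)
  have "\<forall>e. J br u (x + y) \<bullet> e = (J br u x + J br u y) \<bullet> e"
    by (simp add: s)
  then show "J br u (x + y) = J br u x + J br u y" by (metis vector_eq_rdot)
  have "\<forall>e. J br (r *\<^sub>R u) x \<bullet> e = (r *\<^sub>R J br u x) \<bullet> e"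
    by (simp add: s)
  then show "J br (r *\<^sub>R u) x = r *\<^sub>R J br u x" by (metis vector_eq_rdot)
  have "\<forall>e. J br u (r *\<^sub>R x) \<bullet> e = (r *\<^sub>R J br u x) \<bullet> e"
    by (simp add: s)
  then show "J br u (r *\<^sub>R x) = r *\<^sub>R J br u x" by (metis vector_eq_rdot)
qed

lemma h_type_group_bracket_self:
  assumes "h_type_group br"
  shows "br x x = 0"
proof -
  have "full_bracket br (x, 0) (x, 0) = 0"
    using assms by (simp add: h_type_group_def h_type_algebra_def lie_algebra_def)
  then show ?thesis by (simp add: full_bracket_def zero_prod_def)
qed

lemma h_type_group_bracket_skew:
  assumes H: "h_type_group br"
  shows "br x y = - br y x"
proof -
  note B = h_type_group_bilinear[OF H]
  have "br x x + br x y + (br y x + br y y) = 0"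
    using h_type_group_bracket_self[OF H, of "x + y"]
    by (simp add: bilinear_ladd[OF B] bilinear_radd[OF B] algebra_simps)
  then show ?thesis
    by (simp add: h_type_group_bracket_self[OF H] eq_neg_iff_add_eq_0)
qed

text \<open>The axiom speaks of the full Lie algebra. The complement of its center
  \<open>{0} \<times> UNIV\<close> consists of the pairs with second component 0, and there the
  \<open>J_map\<close> of the full bracket is \<open>J br\<close> in the first component.\<close>

lemma h_type_group_J_orthogonal:
  fixes br :: "real^'d \<Rightarrow> real^'d \<Rightarrow> real^'m"
  assumes H: "h_type_group br" and "norm \<eta> = 1"
  shows "J br \<eta> x \<bullet> J br \<eta> y = x \<bullet> y"
proof -
  let ?V = "({0} \<times> UNIV :: ((real^'d) \<times> (real^'m)) set)\<^sup>\<bottom>"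
  have V: "p \<in> ?V \<longleftrightarrow> snd p = 0" for p
  proof
    assume "p \<in> ?V"
    then have "(0, snd p) \<bullet> p = 0"
      unfolding orthogonal_comp_def orthogonal_def by blast
    then show "snd p = 0" by (simp add: inner_prod_def)
  qed (auto simp: orthogonal_comp_def orthogonal_def inner_prod_def)
  have J: "J_map ?V (full_bracket br) (0, \<eta>) (v, 0) = (J br \<eta> v, 0)" for v
    unfolding J_map_def[of ?V]
  proof (rule the_equality)
    fix w assume w: "w \<in> ?V \<and> (\<forall>y\<in>?V. w \<bullet> y = (0, \<eta>) \<bullet> full_bracket br (v, 0) y)"
    have "\<forall>e. fst w \<bullet> e = J br \<eta> v \<bullet> e"
    proof
      fix e
      have "w \<bullet> (e, 0) = (0, \<eta>) \<bullet> full_bracket br (v, 0) (e, 0)"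
        using w V by auto
      then show "fst w \<bullet> e = J br \<eta> v \<bullet> e"
        by (simp add: inner_prod_def full_bracket_def J_inner[OF h_type_group_bilinear[OF H]])
    qed
    then have "fst w = J br \<eta> v" by (metis vector_eq_rdot)
    then show "w = (J br \<eta> v, 0)"
      using w V by (simp add: prod_eq_iff)
  qed (auto simp: V inner_prod_def full_bracket_def J_inner[OF h_type_group_bilinear[OF H]])
  have C: "lie_center (full_bracket br) = {0} \<times> UNIV"
    and "h_type_algebra (full_bracket br)"
    using H by (simp_all add: h_type_group_def)
  then have orth: "\<forall>z\<in>{0} \<times> UNIV. z \<bullet> z = 1 \<longrightarrow>
        (\<forall>x\<in>?V. \<forall>y\<in>?V. J_map ?V (full_bracket br) z x \<bullet> J_map ?V (full_bracket br) z y = x \<bullet> y)"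
    unfolding h_type_algebra_def C by blast
  have "J_map ?V (full_bracket br) (0, \<eta>) (x, 0) \<bullet> J_map ?V (full_bracket br) (0, \<eta>) (y, 0)
      = (x, 0) \<bullet> (y, 0)"
    using \<open>norm \<eta> = 1\<close> orth[rule_format, of "(0, \<eta>)" "(x, 0)" "(y, 0)"]
    by (simp add: V inner_prod_def norm_eq_1)
  then show ?thesis
    by (simp add: J inner_prod_def)
qed

lemma J_inner_J:
  assumes H: "h_type_group br"
  shows "J br \<eta> x \<bullet> J br \<eta> y = (norm \<eta>)\<^sup>2 * (x \<bullet> y)"
proof (cases "\<eta> = 0")
  case True
  then show ?thesis
    by (simp add: bilinear_lzero[OF bilinear_J[OF h_type_group_bilinear[OF H]]])
next
  case False
  let ?u = "(1 / norm \<eta>) *\<^sub>R \<eta>"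
  have "J br \<eta> v = norm \<eta> *\<^sub>R J br ?u v" for v
    using False by (simp add: bilinear_lmul[OF bilinear_J[OF h_type_group_bilinear[OF H]]])
  moreover have "J br ?u x \<bullet> J br ?u y = x \<bullet> y"
    using False by (intro h_type_group_J_orthogonal[OF H]) simp
  ultimately show ?thesis by (simp add: power2_eq_square)
qed

lemma J_skew:
  assumes H: "h_type_group br"
  shows "J br \<eta> x \<bullet> y = - (x \<bullet> J br \<eta> y)"
proof -
  show ?thesis
    by (simp add: inner_commute[of x] J_inner[OF h_type_group_bilinear[OF H]]
        h_type_group_bracket_skew[OF H, of x y])
qed

text \<open>Skewness moves one J across the inner product and \<open>J_inner_J\<close> evaluates the
  rest. This Clifford relation makes the flow a rotation.\<close>

lemma J_J:
  assumes H: "h_type_group br"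
  shows "J br \<eta> (J br \<eta> x) = - ((norm \<eta>)\<^sup>2 *\<^sub>R x)"
proof -
  have "\<forall>e. J br \<eta> (J br \<eta> x) \<bullet> e = - ((norm \<eta>)\<^sup>2 *\<^sub>R x) \<bullet> e"
    by (simp add: J_skew[OF H, of _ "J br \<eta> x"] J_inner_J[OF H])
  then show ?thesis by (metis vector_eq_rdot)
qed

text \<open>Polarizing \<open>J_inner_J\<close> in \<eta> gives \<open>J br \<zeta> x \<bullet> J br
  \<eta> x = (\<zeta> \<bullet> \<eta>) * (norm x)\<^sup>2\<close>, and the left side is \<zeta>
  paired with the bracket.\<close>

lemma bracket_J:
  assumes H: "h_type_group br"
  shows "br x (J br \<eta> x) = (norm x)\<^sup>2 *\<^sub>R \<eta>"
proof -
  note B = h_type_group_bilinear[OF H]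
  have "\<zeta> \<bullet> br x (J br \<eta> x) = \<zeta> \<bullet> ((norm x)\<^sup>2 *\<^sub>R \<eta>)" for \<zeta>
  proof -
    have "J br (\<zeta> + \<eta>) x \<bullet> J br (\<zeta> + \<eta>) x = (norm (\<zeta> + \<eta>))\<^sup>2 * (x \<bullet> x)"
      by (rule J_inner_J[OF H])
    then have "J br \<zeta> x \<bullet> J br \<eta> x = (\<zeta> \<bullet> \<eta>) * (norm x)\<^sup>2"
      by (simp add: bilinear_ladd[OF bilinear_J[OF B]] inner_add_left inner_add_right J_inner_J[OF H]
          power2_norm_eq_inner inner_commute[of \<eta> \<zeta>] inner_commute[of "J br \<eta> x" "J br \<zeta> x"]
          algebra_simps)
    then show ?thesis
      by (simp add: J_inner[OF B])
  qed
  then show ?thesis by (metis vector_eq_ldot)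
qed

text \<open>On the span of \<open>x\<close> and \<open>J br \<eta> x\<close> the bracket is a
  determinant times a fixed vector, so a curve rotating there has vertical velocity along
  \<eta>.\<close>

lemma bracket_rotated:
  assumes H: "h_type_group br"
  shows "br (p *\<^sub>R x + q *\<^sub>R J br \<eta> x) (r *\<^sub>R x + s *\<^sub>R J br \<eta> x) = ((p * s - q * r) * (norm x)\<^sup>2) *\<^sub>R \<eta>"
proof -
  note B = h_type_group_bilinear[OF H]
  have "br (J br \<eta> x) x = - ((norm x)\<^sup>2 *\<^sub>R \<eta>)"
    using h_type_group_bracket_skew[OF H, of "J br \<eta> x" x] by (simp add: bracket_J[OF H])
  then show ?thesis
    by (simp add: bilinear_ladd[OF B] bilinear_radd[OF B] bilinear_lmul[OF B] bilinear_rmul[OF B]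
        h_type_group_bracket_self[OF H] bracket_J[OF H] algebra_simps)
qed

text \<open>Pythagoras: by skewness \<open>J br \<eta> x\<close> is orthogonal to \<open>x\<close>,
  and its length is |\<eta>| |x|.\<close>

lemma norm_rotated_sq:
  assumes H: "h_type_group br"
  shows "(norm (p *\<^sub>R x + q *\<^sub>R J br \<eta> x))\<^sup>2 = (p\<^sup>2 + q\<^sup>2 * (norm \<eta>)\<^sup>2) * (norm x)\<^sup>2"
proof -
  have "J br \<eta> x \<bullet> x = 0"
    using J_skew[OF H, of \<eta> x x] by (simp add: inner_commute[of x])
  then show ?thesis
    unfolding power2_norm_eq_inner[of "p *\<^sub>R x + q *\<^sub>R J br \<eta> x"]
    by (simp add: inner_add_left inner_add_right J_inner_J[OF H] inner_commute[of x "J br \<eta> x"]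
        power2_norm_eq_inner[of x]) (simp add: power2_eq_square algebra_simps)
qed

section \<open>Hamilton's equations in explicit form\<close>

text \<open>Gradients are unique, so the existentially quantified derivatives can be replaced by the
  gradients computed from the norm formula for the Hamiltonian.\<close>

lemma hamilton_solution_iff:
  fixes br :: "real^'d \<Rightarrow> real^'d \<Rightarrow> real^'m"
  assumes H: "h_type_group br"
  shows "hamilton_solution (hamiltonian br) x z \<xi> \<eta> \<longleftrightarrow>
    (\<forall>t\<in>{0..1}.
       (x has_vector_derivative \<xi> t + (1/2) *\<^sub>R J br (\<eta> t) (x t)) (at t within {0..1}) \<and>
       (z has_vector_derivative (1/2) *\<^sub>R br (x t) (\<xi> t + (1/2) *\<^sub>R J br (\<eta> t) (x t))) (at t within {0..1}) \<and>
       (\<xi> has_vector_derivative (1/2) *\<^sub>R J br (\<eta> t) (\<xi> t + (1/2) *\<^sub>R J br (\<eta> t) (x t))) (at t within {0..1}) \<and>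
       (\<eta> has_vector_derivative 0) (at t within {0..1}))"
proof -
  note B = h_type_group_bilinear[OF H]
  note JB = bilinear_J[OF B]
  define P where "P y p q = p + (1/2) *\<^sub>R J br q y" for y p q
  have grad1: "GDERIV (\<lambda>p. hamiltonian br y w p q) p :> P y p q" for y w p q
    using GDERIV_half_norm_sq[of "\<lambda>p. p" "P y p q" "(1/2) *\<^sub>R J br q y" p]
    by (simp add: P_def hamiltonian_eq[OF B] add.commute linear_iff)
  have grad2: "GDERIV (\<lambda>q. hamiltonian br y w p q) q :> (1/2) *\<^sub>R br y (P y p q)" for y w p q
    using GDERIV_half_norm_sq[of "\<lambda>q. (1/2) *\<^sub>R J br q y" "(1/2) *\<^sub>R br y (P y p q)" p q]
    by (simp add: P_def[symmetric] hamiltonian_eq[OF B] linear_iff bilinear_ladd[OF JB]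
        bilinear_lmul[OF JB] scaleR_add_right inner_commute[of "P y p q"] J_inner[OF B]
        inner_commute[of "br y (P y p q)"])
  \<comment> \<open>Skewness of J produces the minus sign, which cancels against the one in
    Hamilton's equation for \<xi>.\<close>
  have grad3: "GDERIV (\<lambda>y. hamiltonian br y w p q) y :> - ((1/2) *\<^sub>R J br q (P y p q))" for y w p q
    using GDERIV_half_norm_sq[of "\<lambda>y. (1/2) *\<^sub>R J br q y" "- ((1/2) *\<^sub>R J br q (P y p q))" p y]
    by (simp add: P_def[symmetric] hamiltonian_eq[OF B] linear_iff bilinear_radd[OF JB]
        bilinear_rmul[OF JB] scaleR_add_right J_skew[OF H, of q "P y p q"])
  \<comment> \<open>The Hamiltonian does not depend on \<open>w\<close>; the zero is written
    \<open>- 0\<close> to match the form \<open>- \<eta>'\<close> in the equations.\<close>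
  have grad4: "GDERIV (\<lambda>w. hamiltonian br y w p q) w :> - 0" for y w p q
    unfolding hamiltonian_eq[OF B] gderiv_def by simp
  show ?thesis
    unfolding hamilton_solution_def P_def[symmetric]
  proof (intro ball_cong refl iffI)
    fix t :: real
    assume "\<exists>x' z' \<xi>' \<eta>'.
        (x has_vector_derivative x') (at t within {0..1}) \<and>
        (z has_vector_derivative z') (at t within {0..1}) \<and>
        (\<xi> has_vector_derivative \<xi>') (at t within {0..1}) \<and>
        (\<eta> has_vector_derivative \<eta>') (at t within {0..1}) \<and>
        GDERIV (\<lambda>p. hamiltonian br (x t) (z t) p (\<eta> t)) (\<xi> t) :> x' \<and>
        GDERIV (\<lambda>q. hamiltonian br (x t) (z t) (\<xi> t) q) (\<eta> t) :> z' \<and>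
        GDERIV (\<lambda>y. hamiltonian br y (z t) (\<xi> t) (\<eta> t)) (x t) :> (- \<xi>') \<and>
        GDERIV (\<lambda>w. hamiltonian br (x t) w (\<xi> t) (\<eta> t)) (z t) :> (- \<eta>')"
    then obtain x' z' \<xi>' \<eta>' where
      d: "(x has_vector_derivative x') (at t within {0..1})"
        "(z has_vector_derivative z') (at t within {0..1})"
        "(\<xi> has_vector_derivative \<xi>') (at t within {0..1})"
        "(\<eta> has_vector_derivative \<eta>') (at t within {0..1})" and
      g: "GDERIV (\<lambda>p. hamiltonian br (x t) (z t) p (\<eta> t)) (\<xi> t) :> x'"
        "GDERIV (\<lambda>q. hamiltonian br (x t) (z t) (\<xi> t) q) (\<eta> t) :> z'"
        "GDERIV (\<lambda>y. hamiltonian br y (z t) (\<xi> t) (\<eta> t)) (x t) :> (- \<xi>')"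
        "GDERIV (\<lambda>w. hamiltonian br (x t) w (\<xi> t) (\<eta> t)) (z t) :> (- \<eta>')"
      by blast
    have "x' = P (x t) (\<xi> t) (\<eta> t)" "z' = (1/2) *\<^sub>R br (x t) (P (x t) (\<xi> t) (\<eta> t))"
      "- \<xi>' = - ((1/2) *\<^sub>R J br (\<eta> t) (P (x t) (\<xi> t) (\<eta> t)))" "- \<eta>' = - 0"
      by (rule GDERIV_unique[OF g(1) grad1] GDERIV_unique[OF g(2) grad2]
          GDERIV_unique[OF g(3) grad3] GDERIV_unique[OF g(4) grad4])+
    with d show "(x has_vector_derivative P (x t) (\<xi> t) (\<eta> t)) (at t within {0..1}) \<and>
       (z has_vector_derivative (1/2) *\<^sub>R br (x t) (P (x t) (\<xi> t) (\<eta> t))) (at t within {0..1}) \<and>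
       (\<xi> has_vector_derivative (1/2) *\<^sub>R J br (\<eta> t) (P (x t) (\<xi> t) (\<eta> t))) (at t within {0..1}) \<and>
       (\<eta> has_vector_derivative 0) (at t within {0..1})"
      by simp
  qed (elim conjE, intro exI conjI, (assumption | rule grad1 grad2 grad3 grad4)+)
qed

section \<open>Closed form of the trajectories\<close>

text \<open>
  The functions \<open>sn a\<close>, \<open>vs a\<close> and \<open>ts a\<close> are the iterated integrals from 0 of \<open>\<lambda>t. cos (a * t)\<close>. Their
  values at \<open>a = 0\<close> are the limits, so that straight lines (\<open>\<eta> = 0\<close>) need no separate treatment.
\<close>

definition sn :: "real \<Rightarrow> real \<Rightarrow> real" where
  "sn a t = (if a = 0 then t else sin (a * t) / a)"

definition vs :: "real \<Rightarrow> real \<Rightarrow> real" where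
  "vs a t = (if a = 0 then t\<^sup>2 / 2 else (1 - cos (a * t)) / a\<^sup>2)"

definition ts :: "real \<Rightarrow> real \<Rightarrow> real" where
  "ts a t = (if a = 0 then t ^ 3 / 6 else (a * t - sin (a * t)) / a ^ 3)"

lemma DERIV_sn: "(sn a has_field_derivative cos (a * t)) (at t within S)"
proof (cases "a = 0")
  case True
  then show ?thesis unfolding sn_def by (auto intro!: derivative_eq_intros)
next
  case False
  then show ?thesis unfolding sn_def by (auto intro!: derivative_eq_intros)
qed

lemma DERIV_vs: "(vs a has_field_derivative sn a t) (at t within S)"
proof (cases "a = 0")
  case True
  then show ?thesis unfolding vs_def sn_def by (auto intro!: derivative_eq_intros)
next
  case False
  then show ?thesis unfolding vs_def sn_def
    by (auto intro!: derivative_eq_intros simp: power2_eq_square)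
qed

lemma DERIV_ts: "(ts a has_field_derivative vs a t) (at t within S)"
proof (cases "a = 0")
  case True
  then show ?thesis unfolding ts_def vs_def
    by (auto intro!: derivative_eq_intros)
next
  case False
  then show ?thesis unfolding vs_def ts_def
    by (auto intro!: derivative_eq_intros simp: field_simps power2_eq_square power3_eq_cube)
qed

lemma DERIV_cos_sn: "((\<lambda>t. cos (a * t)) has_field_derivative - (a\<^sup>2 * sn a t)) (at t within S)"
  unfolding sn_def by (auto intro!: derivative_eq_intros simp: power2_eq_square)

text \<open>For \<open>a \<noteq> 0\<close> this is sin^2 - (1 - cos) cos = 1 - cos, divided by a^2.
  The left side is the determinant that occurs in the bracket of position and velocity.\<close>

lemma sn_vs: "(sn a t)\<^sup>2 - vs a t * cos (a * t) = vs a t"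
proof (cases "a = 0")
  case False
  have "(sin (a * t))\<^sup>2 = (1 - cos (a * t)) * (1 + cos (a * t))"
    by (simp add: sin_squared_eq power2_eq_square algebra_simps)
  then show ?thesis
    using False by (simp add: sn_def vs_def power_divide) (simp add: field_simps)
qed (simp add: sn_def vs_def)

text \<open>Here \<open>\<xi>\<close> is both initial momentum and initial velocity: the two differ
  by \<open>(1/2) *\<^sub>R J br \<eta> x\<close>, which vanishes at the origin.\<close>

definition geodesic_x :: "(real^'d \<Rightarrow> real^'d \<Rightarrow> real^'m) \<Rightarrow> real^'m \<Rightarrow> real^'d \<Rightarrow> real \<Rightarrow> real^'d" where
  "geodesic_x br \<eta> \<xi> t = sn (norm \<eta>) t *\<^sub>R \<xi> + vs (norm \<eta>) t *\<^sub>R J br \<eta> \<xi>"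

definition geodesic_z :: "real^'m \<Rightarrow> real^'d \<Rightarrow> real \<Rightarrow> real^'m" where
  "geodesic_z \<eta> \<xi> t = ((norm \<xi>)\<^sup>2 / 2 * ts (norm \<eta>) t) *\<^sub>R \<eta>"

definition geodesic_velocity :: "(real^'d \<Rightarrow> real^'d \<Rightarrow> real^'m) \<Rightarrow> real^'m \<Rightarrow> real^'d \<Rightarrow> real \<Rightarrow> real^'d" where
  "geodesic_velocity br \<eta> \<xi> t = cos (norm \<eta> * t) *\<^sub>R \<xi> + sn (norm \<eta>) t *\<^sub>R J br \<eta> \<xi>"

lemma has_vector_derivative_scaleR_const:
  assumes "(f has_field_derivative f') (at t within S)"
  shows "((\<lambda>t. f t *\<^sub>R v) has_vector_derivative f' *\<^sub>R v) (at t within S)"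
  using has_vector_derivative_scaleR[OF assms has_vector_derivative_const] by simp

lemma geodesic_x_deriv:
  "(geodesic_x br \<eta> \<xi> has_vector_derivative geodesic_velocity br \<eta> \<xi> t) (at t within S)"
  unfolding geodesic_x_def[abs_def] geodesic_velocity_def
  by (intro has_vector_derivative_add has_vector_derivative_scaleR_const DERIV_sn DERIV_vs)

text \<open>By \<open>J_J\<close>, applying \<open>J br \<eta>\<close> changes the coefficients
  \<open>cos\<close> and \<open>sn\<close> in the same way as differentiating them.\<close>

lemma geodesic_velocity_deriv:
  assumes H: "h_type_group br"
  shows "(geodesic_velocity br \<eta> \<xi> has_vector_derivative J br \<eta> (geodesic_velocity br \<eta> \<xi> t)) (at t within S)"
proof -
  note JB = bilinear_J[OF h_type_group_bilinear[OF H]]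
  have "J br \<eta> (geodesic_velocity br \<eta> \<xi> t)
      = - ((norm \<eta>)\<^sup>2 * sn (norm \<eta>) t) *\<^sub>R \<xi> + cos (norm \<eta> * t) *\<^sub>R J br \<eta> \<xi>"
    by (simp add: geodesic_velocity_def bilinear_radd[OF JB] bilinear_rmul[OF JB] J_J[OF H] mult.commute)
  then show ?thesis
    unfolding geodesic_velocity_def[abs_def]
    by (auto intro!: has_vector_derivative_add has_vector_derivative_scaleR_const DERIV_sn DERIV_cos_sn
        simp del: scaleR_minus_left)
qed

lemma bracket_geodesic:
  assumes H: "h_type_group br"
  shows "br (geodesic_x br \<eta> \<xi> t) (geodesic_velocity br \<eta> \<xi> t) = (vs (norm \<eta>) t * (norm \<xi>)\<^sup>2) *\<^sub>R \<eta>"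
  unfolding geodesic_x_def geodesic_velocity_def bracket_rotated[OF H]
  using sn_vs[of "norm \<eta>" t] by (simp add: power2_eq_square)

lemma geodesic_z_deriv:
  assumes H: "h_type_group br"
  shows "(geodesic_z \<eta> \<xi> has_vector_derivative
    (1/2) *\<^sub>R br (geodesic_x br \<eta> \<xi> t) (geodesic_velocity br \<eta> \<xi> t)) (at t within S)"
proof -
  have "((\<lambda>t. (norm \<xi>)\<^sup>2 / 2 * ts (norm \<eta>) t) has_field_derivative (norm \<xi>)\<^sup>2 / 2 * vs (norm \<eta>) t) (at t within S)"
    by (intro DERIV_cmult DERIV_ts)
  from has_vector_derivative_scaleR_const[OF this, of \<eta>] show ?thesis
    unfolding bracket_geodesic[OF H] geodesic_z_def[abs_def] by (simp add: mult_ac)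
qed

lemma geodesic_0 [simp]: "geodesic_x br \<eta> \<xi> 0 = 0" "geodesic_z \<eta> \<xi> 0 = 0" "geodesic_velocity br \<eta> \<xi> 0 = \<xi>"
  by (simp_all add: geodesic_x_def geodesic_z_def geodesic_velocity_def sn_def vs_def ts_def)

lemma J_has_vector_derivative:
  assumes "h_type_group br" "(f has_vector_derivative f') (at t within S)"
  shows "((\<lambda>t. J br \<eta> (f t)) has_vector_derivative J br \<eta> f') (at t within S)"
  using assms bilinear_J[OF h_type_group_bilinear]
  by (intro bounded_linear.has_vector_derivative[of "J br \<eta>"])
    (auto simp: bilinear_def linear_conv_bounded_linear)

section \<open>Identification of the solutions from the origin\<close>

text \<open>The system is solved in triangular order: \<eta> is constant, the velocity then obeys a
  linear equation with a fixed skew operator, and \<open>x\<close> and \<open>z\<close> follow by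
  integration.\<close>

lemma hamilton_solution_unique:
  assumes H: "h_type_group br" and sol: "hamilton_solution (hamiltonian br) x z \<xi> \<eta>"
    and "x 0 = 0" "z 0 = 0" and t: "t \<in> {0..1}"
  shows "x t = geodesic_x br (\<eta> 0) (\<xi> 0) t \<and> z t = geodesic_z (\<eta> 0) (\<xi> 0) t"
proof -
  note JB = bilinear_J[OF h_type_group_bilinear[OF H]]
  define p where "p t = \<xi> t + (1/2) *\<^sub>R J br (\<eta> t) (x t)" for t
  have x: "(x has_vector_derivative p t) (at t within {0..1})"
    and z: "(z has_vector_derivative (1/2) *\<^sub>R br (x t) (p t)) (at t within {0..1})"
    and xi: "(\<xi> has_vector_derivative (1/2) *\<^sub>R J br (\<eta> t) (p t)) (at t within {0..1})"
    and eta: "(\<eta> has_vector_derivative 0) (at t within {0..1})"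
    if "t \<in> {0..1}" for t
    using sol that unfolding hamilton_solution_iff[OF H] p_def by auto
  have eta0: "\<eta> t = \<eta> 0" if "t \<in> {0..1}" for t
    by (rule vector_derivative_eq_unique[where S = "{0..1}" and s = 0 and D = "\<lambda>_. 0"])
      (use that eta in auto)
  \<comment> \<open>On \<open>{0..1}\<close> the covector \<eta> is frozen at its initial value;
    half of the right side then comes from the derivative of \<xi> and half from that of
    \<open>x\<close>.\<close>
  have p': "(p has_vector_derivative J br (\<eta> 0) (p t)) (at t within {0..1})" if "t \<in> {0..1}" for t
  proof (rule has_vector_derivative_transform[OF that])
    have "((\<lambda>t. \<xi> t + (1/2) *\<^sub>R J br (\<eta> 0) (x t)) has_vector_derivative
        (1/2) *\<^sub>R J br (\<eta> t) (p t) + (1/2) *\<^sub>R J br (\<eta> 0) (p t)) (at t within {0..1})"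
      by (intro has_vector_derivative_add xi that bounded_linear.has_vector_derivative[OF bounded_linear_scaleR_right]
          J_has_vector_derivative[OF H] x)
    then show "((\<lambda>t. \<xi> t + (1/2) *\<^sub>R J br (\<eta> 0) (x t)) has_vector_derivative J br (\<eta> 0) (p t)) (at t within {0..1})"
      unfolding eta0[OF that] scaleR_add_left[symmetric] by simp
  qed (metis p_def eta0)
  have p: "p t = geodesic_velocity br (\<eta> 0) (\<xi> 0) t" if "t \<in> {0..1}" for t
  proof (rule skew_ode_unique[where S = "{0..1}" and s = 0 and A = "J br (\<eta> 0)"])
    show "linear (J br (\<eta> 0))"
      using JB by (simp add: bilinear_def)
    show "J br (\<eta> 0) v \<bullet> v = 0" for v
      using J_skew[OF H, of "\<eta> 0" v v] by (simp add: inner_commute[of v])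
    show "p 0 = geodesic_velocity br (\<eta> 0) (\<xi> 0) 0"
      using \<open>x 0 = 0\<close> by (simp add: p_def bilinear_rzero[OF JB])
  qed (use that p' geodesic_velocity_deriv[OF H] in auto)
  have x_eq: "x t = geodesic_x br (\<eta> 0) (\<xi> 0) t" if "t \<in> {0..1}" for t
    by (rule vector_derivative_eq_unique[where S = "{0..1}" and s = 0 and D = p])
      (use that x geodesic_x_deriv \<open>x 0 = 0\<close> p in auto)
  have "z t = geodesic_z (\<eta> 0) (\<xi> 0) t"
    by (rule vector_derivative_eq_unique[where S = "{0..1}" and s = 0 and D = "\<lambda>t. (1/2) *\<^sub>R br (x t) (p t)"])
      (use t z geodesic_z_deriv[OF H] \<open>z 0 = 0\<close> p x_eq in auto)
  with x_eq[OF t] show ?thesis by simp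
qed

text \<open>The momentum is found by solving velocity = \<xi> + (1/2) J x for \<xi>. It is written
  with the globally defined closed forms because \<open>x\<close> and \<open>z\<close> are known
  only on \<open>{0..1}\<close>.\<close>

lemma hamilton_solution_geodesic:
  assumes H: "h_type_group br"
    and x: "\<And>t. t \<in> {0..1} \<Longrightarrow> x t = geodesic_x br \<eta> \<xi> t"
    and z: "\<And>t. t \<in> {0..1} \<Longrightarrow> z t = geodesic_z \<eta> \<xi> t"
  shows "hamilton_solution (hamiltonian br) x z
    (\<lambda>t. geodesic_velocity br \<eta> \<xi> t - (1/2) *\<^sub>R J br \<eta> (geodesic_x br \<eta> \<xi> t)) (\<lambda>_. \<eta>)"
  unfolding hamilton_solution_iff[OF H]
proof (intro ballI conjI)
  fix t :: real assume t: "t \<in> {0..1}"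
  let ?v = "geodesic_velocity br \<eta> \<xi> t"
  have v: "?v - (1/2) *\<^sub>R J br \<eta> (geodesic_x br \<eta> \<xi> t) + (1/2) *\<^sub>R J br \<eta> (x t) = ?v"
    using x[OF t] by simp
  show "(x has_vector_derivative ?v - (1/2) *\<^sub>R J br \<eta> (geodesic_x br \<eta> \<xi> t) + (1/2) *\<^sub>R J br \<eta> (x t))
      (at t within {0..1})"
    unfolding v by (rule has_vector_derivative_transform[OF t x geodesic_x_deriv])
  show "(z has_vector_derivative (1/2) *\<^sub>R
      br (x t) (?v - (1/2) *\<^sub>R J br \<eta> (geodesic_x br \<eta> \<xi> t) + (1/2) *\<^sub>R J br \<eta> (x t))) (at t within {0..1})"
    unfolding v using has_vector_derivative_transform[OF t z geodesic_z_deriv[OF H]]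
    by (simp only: x[OF t])
  have "((\<lambda>t. geodesic_velocity br \<eta> \<xi> t - (1/2) *\<^sub>R J br \<eta> (geodesic_x br \<eta> \<xi> t)) has_vector_derivative
      J br \<eta> ?v - (1/2) *\<^sub>R J br \<eta> ?v) (at t within {0..1})"
    by (intro has_vector_derivative_diff geodesic_velocity_deriv[OF H]
        bounded_linear.has_vector_derivative[OF bounded_linear_scaleR_right]
        J_has_vector_derivative[OF H] geodesic_x_deriv)
  moreover have "J br \<eta> ?v - (1/2) *\<^sub>R J br \<eta> ?v = (1/2) *\<^sub>R J br \<eta> ?v"
    by (simp add: algebra_simps flip: scaleR_add_left)
  ultimately show "((\<lambda>t. geodesic_velocity br \<eta> \<xi> t - (1/2) *\<^sub>R J br \<eta> (geodesic_x br \<eta> \<xi> t)) has_vector_derivative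
      (1/2) *\<^sub>R J br \<eta> (?v - (1/2) *\<^sub>R J br \<eta> (geodesic_x br \<eta> \<xi> t) + (1/2) *\<^sub>R J br \<eta> (x t))) (at t within {0..1})"
    unfolding v by simp
qed simp

lemma hamilton_projection_iff:
  assumes H: "h_type_group br"
  shows "(\<exists>\<xi> \<eta>. hamilton_solution (hamiltonian br) x z \<xi> \<eta>) \<and> x 0 = 0 \<and> z 0 = 0 \<longleftrightarrow>
    (\<exists>\<eta> \<xi>. \<forall>t\<in>{0..1}. x t = geodesic_x br \<eta> \<xi> t \<and> z t = geodesic_z \<eta> \<xi> t)" (is "?L \<longleftrightarrow> ?R")
proof
  assume ?L
  then show ?R using hamilton_solution_unique[OF H] by blast
next
  assume ?R
  then obtain \<eta> \<xi> where *: "\<And>t. t \<in> {0..1} \<Longrightarrow> x t = geodesic_x br \<eta> \<xi> t"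
    "\<And>t. t \<in> {0..1} \<Longrightarrow> z t = geodesic_z \<eta> \<xi> t" by blast
  then show ?L
    using hamilton_solution_geodesic[OF H *] *[of 0] by auto
qed

section \<open>Exponential form of the trajectories and their values at time 1\<close>

lemma geodesic_eta_0:
  assumes H: "h_type_group br"
  shows "geodesic_x br 0 \<xi> t = t *\<^sub>R \<xi>" "geodesic_z 0 \<xi> t = 0"
  by (simp_all add: geodesic_x_def geodesic_z_def sn_def
      bilinear_lzero[OF bilinear_J[OF h_type_group_bilinear[OF H]]])

lemma op_exp_J:
  assumes H: "h_type_group br" and "\<eta> \<noteq> 0"
  shows "op_exp (\<lambda>v. t *\<^sub>R J br \<eta> v) v
    = cos (norm \<eta> * t) *\<^sub>R v + (sin (norm \<eta> * t) / norm \<eta>) *\<^sub>R J br \<eta> v"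
  using assms bilinear_J[OF h_type_group_bilinear[OF H]]
  by (intro op_exp_rotation J_J) (auto simp: bilinear_def)

text \<open>By \<open>op_exp_J\<close> the vector inside is (1 - cos) \<xi> - (sin / |\<eta>|) J
  \<xi>; applying J, using \<open>J_J\<close> and dividing by |\<eta>|^2 gives the coefficients
  \<open>sn\<close> and \<open>vs\<close>.\<close>

lemma geodesic_x_eq_op_exp:
  assumes H: "h_type_group br" and "\<eta> \<noteq> 0"
  shows "(1 / (norm \<eta>)\<^sup>2) *\<^sub>R J br \<eta> (\<xi> - op_exp (\<lambda>v. t *\<^sub>R J br \<eta> v) \<xi>) = geodesic_x br \<eta> \<xi> t"
proof -
  note JB = bilinear_J[OF h_type_group_bilinear[OF H]]
  show ?thesis
    using \<open>\<eta> \<noteq> 0\<close>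
    by (simp add: op_exp_J[OF assms] geodesic_x_def sn_def vs_def bilinear_rsub[OF JB] bilinear_radd[OF JB]
        bilinear_rmul[OF JB] J_J[OF H])
      (simp add: algebra_simps diff_divide_distrib power2_eq_square)
qed

lemma geodesic_z_eq:
  assumes "\<eta> \<noteq> 0"
  shows "((norm \<xi>)\<^sup>2 / (2 * norm \<eta> ^ 3) * (norm \<eta> * t - sin (norm \<eta> * t))) *\<^sub>R \<eta> = geodesic_z \<eta> \<xi> t"
  using assms by (simp add: geodesic_z_def ts_def)

text \<open>The squared coefficients combine through sin^2 + (1 - cos)^2 = 2 (1 - cos). For nonzero
  \<xi> the result vanishes exactly when \<open>cos (norm \<eta>) = 1\<close>, which separates x(1)
  = 0 from x(1) \<noteq> 0.\<close>

lemma norm_geodesic_x_1: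
  assumes H: "h_type_group br" and "\<eta> \<noteq> 0"
  shows "(norm (geodesic_x br \<eta> \<xi> 1))\<^sup>2 = 2 * (1 - cos (norm \<eta>)) / (norm \<eta>)\<^sup>2 * (norm \<xi>)\<^sup>2"
proof -
  have "(sin (norm \<eta>))\<^sup>2 + (1 - cos (norm \<eta>))\<^sup>2 = 2 * (1 - cos (norm \<eta>))"
    by (simp add: sin_squared_eq power2_eq_square algebra_simps)
  moreover have "(sn (norm \<eta>) 1)\<^sup>2 + (vs (norm \<eta>) 1)\<^sup>2 * (norm \<eta>)\<^sup>2
      = ((sin (norm \<eta>))\<^sup>2 + (1 - cos (norm \<eta>))\<^sup>2) / (norm \<eta>)\<^sup>2"
    using \<open>\<eta> \<noteq> 0\<close> by (simp add: sn_def vs_def power_divide add_divide_distrib power2_eq_square)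
  ultimately show ?thesis
    by (simp add: geodesic_x_def norm_rotated_sq[OF H])
qed

text \<open>Up to the factor -|\<eta>|^2, the operator J (e^J - I) is the linear map from \<xi> to
  x(1). The norm formula makes it injective when the cosine is not 1, hence bijective in finite
  dimension, so \<open>inv\<close> is a true inverse here.\<close>

lemma geodesic_x_1_inv:
  assumes H: "h_type_group br" and "\<eta> \<noteq> 0" and c: "cos (norm \<eta>) \<noteq> 1"
  shows "geodesic_x br \<eta> \<xi> 1 = x1 \<longleftrightarrow>
    \<xi> = - ((norm \<eta>)\<^sup>2 *\<^sub>R inv (\<lambda>v. J br \<eta> (op_exp (J br \<eta>) v - v)) x1)"
proof -
  note JB = bilinear_J[OF h_type_group_bilinear[OF H]]
  define M where "M = (\<lambda>v. J br \<eta> (op_exp (J br \<eta>) v - v))"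
  have M: "M v = - ((norm \<eta>)\<^sup>2 *\<^sub>R geodesic_x br \<eta> v 1)" for v
    using geodesic_x_eq_op_exp[OF assms(1,2), of v 1, symmetric] \<open>\<eta> \<noteq> 0\<close>
    by (simp add: M_def bilinear_rsub[OF JB])
  have lin: "linear M"
    by (rule linearI)
      (simp_all add: M geodesic_x_def bilinear_radd[OF JB] bilinear_rmul[OF JB] algebra_simps)
  have "inj M"
  proof (rule linear_injective_0[THEN iffD2, OF lin, rule_format])
    fix v assume "M v = 0"
    then have "geodesic_x br \<eta> v 1 = 0" using \<open>\<eta> \<noteq> 0\<close> by (simp add: M)
    then show "v = 0"
      using norm_geodesic_x_1[OF assms(1,2), of v] c \<open>\<eta> \<noteq> 0\<close> by simp
  qed
  then have "bij M"
    using lin by (simp add: bij_def linear_injective_imp_surjective)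
  have "geodesic_x br \<eta> \<xi> 1 = x1 \<longleftrightarrow> M (- ((1 / (norm \<eta>)\<^sup>2) *\<^sub>R \<xi>)) = x1"
    using \<open>\<eta> \<noteq> 0\<close> by (simp add: linear_neg[OF lin] linear_cmul[OF lin]) (simp add: M)
  also have "\<dots> \<longleftrightarrow> - ((1 / (norm \<eta>)\<^sup>2) *\<^sub>R \<xi>) = inv M x1"
    using \<open>bij M\<close> by (metis bij_inv_eq_iff)
  also have "\<dots> \<longleftrightarrow> \<xi> = - ((norm \<eta>)\<^sup>2 *\<^sub>R inv M x1)"
  proof
    assume "- ((1 / (norm \<eta>)\<^sup>2) *\<^sub>R \<xi>) = inv M x1"
    from this[symmetric] show "\<xi> = - ((norm \<eta>)\<^sup>2 *\<^sub>R inv M x1)"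
      using \<open>\<eta> \<noteq> 0\<close> by simp
  qed (use \<open>\<eta> \<noteq> 0\<close> in simp)
  finally show ?thesis by (simp add: M_def)
qed

text \<open>Supplies the positivity of \<open>a - sin a\<close>, on which the sign and the
  nonvanishing of z(1) rest.\<close>

lemma sin_less_self:
  assumes "(0::real) < t"
  shows "sin t < t"
\<comment> \<open>Below 2 < pi the intermediate point of the mean value theorem has cosine less than
  1; from 2 on, sin t \<le> 1 suffices.\<close>
proof (cases "t < 2")
  case True
  obtain c where c: "0 < c" "c < t" "sin t - sin 0 = (t - 0) * cos c"
    using MVT2[OF assms, of sin cos] by (auto simp: DERIV_sin)
  have "cos c < cos 0"
    using c True pi_gt3 by (intro cos_monotone_0_pi) auto
  with c assms show ?thesis by simp
next
  case False
  then show ?thesis using sin_le_one[of t] by linarith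
qed

lemma norm_geodesic_z_1:
  assumes "\<eta> \<noteq> 0"
  shows "norm (geodesic_z \<eta> \<xi> 1) = (norm \<xi>)\<^sup>2 / (2 * (norm \<eta>)\<^sup>2) * (norm \<eta> - sin (norm \<eta>))"
  using sin_less_self[of "norm \<eta>"] assms
  by (simp add: geodesic_z_def ts_def abs_mult) (simp add: power3_eq_cube power2_eq_square)

text \<open>Since \<open>a - sin a\<close> is positive for \<open>a > 0\<close>, z(1) is a
  nonnegative multiple of \<eta>; when nonzero, it has the same unit vector.\<close>

lemma geodesic_z_1_direction:
  assumes "geodesic_z \<eta> \<xi> 1 \<noteq> 0"
  shows "\<eta> = norm \<eta> *\<^sub>R ((1 / norm (geodesic_z \<eta> \<xi> 1)) *\<^sub>R geodesic_z \<eta> \<xi> 1)"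
proof -
  define c where "c = (norm \<xi>)\<^sup>2 / 2 * ts (norm \<eta>) 1"
  have z: "geodesic_z \<eta> \<xi> 1 = c *\<^sub>R \<eta>" by (simp add: geodesic_z_def c_def)
  have "0 \<le> c" "\<eta> \<noteq> 0"
    using assms sin_less_self[of "norm \<eta>"] by (auto simp: z c_def ts_def)
  moreover have "c \<noteq> 0" using assms by (auto simp: z)
  ultimately show ?thesis by (simp add: z)
qed

text \<open>For nonzero \<eta> the positivity of \<open>a - sin a\<close> forces \<xi> = 0, and the
  path is constant; for \<eta> = 0 it is a straight line.\<close>

lemma geodesic_endpoint_0:
  assumes H: "h_type_group br" and z: "geodesic_z \<eta> \<xi> 1 = 0"
  shows "geodesic_x br \<eta> \<xi> t = t *\<^sub>R geodesic_x br \<eta> \<xi> 1 \<and> geodesic_z \<eta> \<xi> t = 0"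
proof (cases "\<eta> = 0")
  case True
  then show ?thesis by (simp add: geodesic_eta_0[OF H])
next
  case False
  with norm_geodesic_z_1[OF False, of \<xi>] sin_less_self[of "norm \<eta>"] z have "\<xi> = 0" by simp
  then show ?thesis
    by (simp add: geodesic_x_def geodesic_z_def
        bilinear_rzero[OF bilinear_J[OF h_type_group_bilinear[OF H]]])
qed

section \<open>The function nu and the endpoint conditions\<close>

lemma nu_half:
  assumes "a \<noteq> 0"
  shows "nu (a / 2) = (a - sin a) / (1 - cos a)"
  using assms by (simp add: nu_def)

lemma half_in_nu_domain:
  assumes "cos a \<noteq> 1"
  shows "a / 2 \<in> nu_domain"
  unfolding nu_domain_def
proof (intro insertI2 DiffI notI)
  assume "a / 2 \<in> {of_int k * pi | k. True}"
  then obtain k :: int where "a = of_int k * 2 * pi" by auto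
  with assms show False by (metis cos_one_2pi_int)
qed simp

text \<open>The numerator of nu has the sign of \<theta> and the denominator is nonnegative. Since
  4|z(1)|/|x(1)|^2 is positive, this excludes negative \<theta>, for which \<eta> would point away
  from z(1).\<close>

lemma nu_pos_imp:
  assumes "\<theta> \<in> nu_domain" "nu \<theta> > 0"
  shows "\<theta> > 0" "cos (2 * \<theta>) \<noteq> 1"
proof -
  show c: "cos (2 * \<theta>) \<noteq> 1"
  proof
    assume "cos (2 * \<theta>) = 1"
    \<comment> \<open>For nonzero \<theta> the denominator is 0, and division by zero has the value
      0.\<close>
    then have "nu \<theta> = 0" by (simp add: nu_def)
    with assms show False by simp
  qed
  have "1 - cos (2 * \<theta>) > 0"
    using cos_le_one[of "2 * \<theta>"] c by linarith
  then have "2 * \<theta> - sin (2 * \<theta>) > 0"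
    using assms(2) by (auto simp: nu_def zero_less_divide_iff split: if_splits)
  then show "\<theta> > 0"
    using sin_less_self[of "- (2 * \<theta>)"] assms(2)
    by (cases "\<theta> = 0"; force simp: nu_def)
qed

text \<open>Both vectors lie on the line of \<open>z1\<close>, so comparing coefficients is
  enough.\<close>

lemma geodesic_z_1_eq_iff:
  assumes "z1 \<noteq> 0" "0 < a" and \<eta>: "\<eta> = a *\<^sub>R ((1 / norm z1) *\<^sub>R z1)"
  shows "geodesic_z \<eta> \<xi> 1 = z1 \<longleftrightarrow> (norm \<xi>)\<^sup>2 * (a - sin a) = 2 * a\<^sup>2 * norm z1"
proof -
  have n: "norm \<eta> = a" using assms by simp
  have "geodesic_z \<eta> \<xi> 1 = ((norm \<xi>)\<^sup>2 * (a - sin a) / (2 * a\<^sup>2 * norm z1)) *\<^sub>R z1"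
    unfolding geodesic_z_def n using assms by (simp add: ts_def power3_eq_cube power2_eq_square)
  then have "geodesic_z \<eta> \<xi> 1 = z1 \<longleftrightarrow> (norm \<xi>)\<^sup>2 * (a - sin a) / (2 * a\<^sup>2 * norm z1) = 1"
    using \<open>z1 \<noteq> 0\<close> by (metis scaleR_cancel_right scaleR_one)
  also have "\<dots> \<longleftrightarrow> (norm \<xi>)\<^sup>2 * (a - sin a) = 2 * a\<^sup>2 * norm z1"
    using assms by (auto simp: divide_eq_1_iff)
  finally show ?thesis .
qed

text \<open>Eliminating |\<xi>| between the length equations for x(1) and z(1) leaves the equation
  for nu. If x(1) = 0, the first equation instead makes |\<eta>| a multiple of 2 pi and the second
  fixes |\<xi>|.\<close>

lemma geodesic_endpoint_iff:
  assumes H: "h_type_group br" and "z1 \<noteq> 0"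
  shows "geodesic_x br \<eta> \<xi> 1 = x1 \<and> geodesic_z \<eta> \<xi> 1 = z1 \<longleftrightarrow>
    (x1 \<noteq> 0 \<longrightarrow> (\<exists>\<theta>\<in>nu_domain. nu \<theta> = 4 * norm z1 / (norm x1)\<^sup>2 \<and>
        \<eta> = (2 * \<theta>) *\<^sub>R ((1 / norm z1) *\<^sub>R z1) \<and>
        \<xi> = - ((norm \<eta>)\<^sup>2 *\<^sub>R inv (\<lambda>v. J br \<eta> (op_exp (J br \<eta>) v - v)) x1))) \<and>
    (x1 = 0 \<longrightarrow> (\<exists>k::int. k \<ge> 1 \<and> \<eta> = (2 * pi * of_int k) *\<^sub>R ((1 / norm z1) *\<^sub>R z1) \<and>
        norm \<xi> = sqrt (4 * of_int k * pi * norm z1)))" (is "?L \<longleftrightarrow> ?R")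
proof -
  \<comment> \<open>The vector equation for z(1) splits into a direction for \<eta> and a scalar
    equation in \<open>a = norm \<eta>\<close>.\<close>
  have ang: "?L \<longleftrightarrow> (\<exists>a>0. \<eta> = a *\<^sub>R ((1 / norm z1) *\<^sub>R z1) \<and>
      (norm \<xi>)\<^sup>2 * (a - sin a) = 2 * a\<^sup>2 * norm z1 \<and> geodesic_x br \<eta> \<xi> 1 = x1)"
  proof
    assume ?L
    then have "\<eta> = norm \<eta> *\<^sub>R ((1 / norm z1) *\<^sub>R z1)"
      using geodesic_z_1_direction[of \<eta> \<xi>] \<open>z1 \<noteq> 0\<close> by simp
    moreover have "\<eta> \<noteq> 0"
      using \<open>?L\<close> \<open>z1 \<noteq> 0\<close> by (auto simp: geodesic_z_def)
    ultimately show "\<exists>a>0. \<eta> = a *\<^sub>R ((1 / norm z1) *\<^sub>R z1) \<and>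
      (norm \<xi>)\<^sup>2 * (a - sin a) = 2 * a\<^sup>2 * norm z1 \<and> geodesic_x br \<eta> \<xi> 1 = x1"
      using \<open>?L\<close> geodesic_z_1_eq_iff[OF \<open>z1 \<noteq> 0\<close>, of "norm \<eta>" \<eta> \<xi>] by (metis zero_less_norm_iff)
  next
    assume "\<exists>a>0. \<eta> = a *\<^sub>R ((1 / norm z1) *\<^sub>R z1) \<and>
      (norm \<xi>)\<^sup>2 * (a - sin a) = 2 * a\<^sup>2 * norm z1 \<and> geodesic_x br \<eta> \<xi> 1 = x1"
    then show ?L using geodesic_z_1_eq_iff[OF \<open>z1 \<noteq> 0\<close>] by metis
  qed
  show ?thesis
  proof (cases "x1 = 0")
    case False
    have "?L \<longleftrightarrow> (\<exists>\<theta>\<in>nu_domain. nu \<theta> = 4 * norm z1 / (norm x1)\<^sup>2 \<and>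
        \<eta> = (2 * \<theta>) *\<^sub>R ((1 / norm z1) *\<^sub>R z1) \<and>
        \<xi> = - ((norm \<eta>)\<^sup>2 *\<^sub>R inv (\<lambda>v. J br \<eta> (op_exp (J br \<eta>) v - v)) x1))" (is "_ \<longleftrightarrow> ?Q")
    proof
      assume ?L
      then obtain a where a: "a > 0" "\<eta> = a *\<^sub>R ((1 / norm z1) *\<^sub>R z1)"
        "(norm \<xi>)\<^sup>2 * (a - sin a) = 2 * a\<^sup>2 * norm z1" and x: "geodesic_x br \<eta> \<xi> 1 = x1"
        using ang by auto
      have n: "norm \<eta> = a" and "\<eta> \<noteq> 0" using a(1,2) \<open>z1 \<noteq> 0\<close> by auto
      have nx: "(norm x1)\<^sup>2 * a\<^sup>2 = 2 * (1 - cos a) * (norm \<xi>)\<^sup>2"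
        using norm_geodesic_x_1[OF H \<open>\<eta> \<noteq> 0\<close>, of \<xi>] a(1) by (simp add: x n)
      then have c: "cos a \<noteq> 1" and "\<xi> \<noteq> 0" using False a(1) by auto
      \<comment> \<open>Multiplying the two length equations exposes the nonzero common factor
        \<open>a\<^sup>2 * (norm \<xi>)\<^sup>2\<close>, which is then cancelled.\<close>
      have "(a - sin a) * (norm x1)\<^sup>2 * (a\<^sup>2 * (norm \<xi>)\<^sup>2)
          = ((norm \<xi>)\<^sup>2 * (a - sin a)) * ((norm x1)\<^sup>2 * a\<^sup>2)" by simp
      also have "\<dots> = 4 * norm z1 * (1 - cos a) * (a\<^sup>2 * (norm \<xi>)\<^sup>2)"
        unfolding a(3) nx by simp
      finally have "(a - sin a) * (norm x1)\<^sup>2 = 4 * norm z1 * (1 - cos a)"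
        using a(1) \<open>\<xi> \<noteq> 0\<close> by simp
      then have "nu (a / 2) = 4 * norm z1 / (norm x1)\<^sup>2"
        using a(1) c False by (simp add: nu_half frac_eq_eq)
      moreover have "\<eta> = (2 * (a / 2)) *\<^sub>R ((1 / norm z1) *\<^sub>R z1)" using a(2) by simp
      moreover have "\<xi> = - ((norm \<eta>)\<^sup>2 *\<^sub>R inv (\<lambda>v. J br \<eta> (op_exp (J br \<eta>) v - v)) x1)"
        using geodesic_x_1_inv[OF H \<open>\<eta> \<noteq> 0\<close>, of \<xi> x1] c x unfolding n by metis
      ultimately show ?Q
        using half_in_nu_domain[OF c] by (intro bexI[of _ "a / 2"] conjI)
    next
      assume ?Q
      then obtain \<theta> where th: "\<theta> \<in> nu_domain" "nu \<theta> = 4 * norm z1 / (norm x1)\<^sup>2"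
        and eta: "\<eta> = (2 * \<theta>) *\<^sub>R ((1 / norm z1) *\<^sub>R z1)"
        and xi: "\<xi> = - ((norm \<eta>)\<^sup>2 *\<^sub>R inv (\<lambda>v. J br \<eta> (op_exp (J br \<eta>) v - v)) x1)" by blast
      define a where "a = 2 * \<theta>"
      have "nu \<theta> > 0" using \<open>z1 \<noteq> 0\<close> False th(2) by simp
      from nu_pos_imp[OF th(1) this] have a: "a > 0" and c: "cos a \<noteq> 1"
        by (simp_all add: a_def)
      have n: "norm \<eta> = a" and "\<eta> \<noteq> 0" using a \<open>z1 \<noteq> 0\<close> eta by (auto simp: a_def)
      have x: "geodesic_x br \<eta> \<xi> 1 = x1"
        using geodesic_x_1_inv[OF H \<open>\<eta> \<noteq> 0\<close>, of \<xi> x1] c xi unfolding n by metis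
      have nx: "(norm x1)\<^sup>2 * a\<^sup>2 = 2 * (1 - cos a) * (norm \<xi>)\<^sup>2"
        using norm_geodesic_x_1[OF H \<open>\<eta> \<noteq> 0\<close>, of \<xi>] a(1) by (simp add: x n)
      have "(a - sin a) * (norm x1)\<^sup>2 = 4 * norm z1 * (1 - cos a)"
        using th(2) nu_half[of a] a c False by (simp add: a_def frac_eq_eq)
      \<comment> \<open>The elimination is reversed: \<open>2 * (1 - cos a)\<close> is nonzero and
        cancels next.\<close>
      then have "2 * (1 - cos a) * ((norm \<xi>)\<^sup>2 * (a - sin a)) = 2 * (1 - cos a) * (2 * a\<^sup>2 * norm z1)"
        using nx by algebra
      then have "(norm \<xi>)\<^sup>2 * (a - sin a) = 2 * a\<^sup>2 * norm z1"
        using c by simp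
      then show ?L unfolding ang using a eta[folded a_def] x by blast
    qed
    with False show ?thesis by simp
  next
    case True
    have "?L \<longleftrightarrow> (\<exists>k::int. k \<ge> 1 \<and> \<eta> = (2 * pi * of_int k) *\<^sub>R ((1 / norm z1) *\<^sub>R z1) \<and>
        norm \<xi> = sqrt (4 * of_int k * pi * norm z1))" (is "_ \<longleftrightarrow> ?Q")
    proof
      assume ?L
      then obtain a where a: "a > 0" "\<eta> = a *\<^sub>R ((1 / norm z1) *\<^sub>R z1)"
        "(norm \<xi>)\<^sup>2 * (a - sin a) = 2 * a\<^sup>2 * norm z1" and x: "geodesic_x br \<eta> \<xi> 1 = 0"
        using ang True by auto
      have n: "norm \<eta> = a" and "\<eta> \<noteq> 0" using a(1,2) \<open>z1 \<noteq> 0\<close> by auto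
      have "\<xi> \<noteq> 0" using a(1,3) \<open>z1 \<noteq> 0\<close> by auto
      \<comment> \<open>With \<xi> nonzero, only full turns lead back to x(1) = 0.\<close>
      then have c: "cos a = 1"
        using norm_geodesic_x_1[OF H \<open>\<eta> \<noteq> 0\<close>, of \<xi>] a(1) by (simp add: x n)
      then obtain k :: int where k: "a = of_int k * 2 * pi" by (metis cos_one_2pi_int)
      have "k \<ge> 1" using a(1) by (simp add: k zero_less_mult_iff)
      have "sin a = 0" using c by (metis cos_one_sin_zero)
      \<comment> \<open>With sin a = 0 the scalar equation becomes |\<xi>|^2 = 2 a |z(1)|, where a =
        2 pi k.\<close>
      then have "(norm \<xi>)\<^sup>2 = 4 * of_int k * pi * norm z1"
        using a(1,3) by (auto simp: power2_eq_square k mult_ac)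
      then have "norm \<xi> = sqrt (4 * of_int k * pi * norm z1)"
        by (metis norm_ge_zero real_sqrt_unique)
      with \<open>k \<ge> 1\<close> a(2) show ?Q by (auto simp: k mult_ac)
    next
      assume ?Q
      then obtain k :: int where k: "k \<ge> 1" "\<eta> = (2 * pi * of_int k) *\<^sub>R ((1 / norm z1) *\<^sub>R z1)"
        "norm \<xi> = sqrt (4 * of_int k * pi * norm z1)" by blast
      define a where "a = 2 * pi * of_int k"
      have a: "a > 0" "cos a = 1" "sin a = 0"
        using k(1) by (simp_all add: a_def cos_int_2pin sin_int_2pin)
      have n: "norm \<eta> = a" and "\<eta> \<noteq> 0" using a(1) \<open>z1 \<noteq> 0\<close> k(2) by (auto simp: a_def)
      have "(norm \<xi>)\<^sup>2 = 2 * a * norm z1"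
        using k(1,3) by (simp add: a_def)
      then have "(norm \<xi>)\<^sup>2 * (a - sin a) = 2 * a\<^sup>2 * norm z1"
        using a by (simp add: power2_eq_square)
      moreover have "geodesic_x br \<eta> \<xi> 1 = 0"
        using a by (simp add: geodesic_x_def n sn_def vs_def)
      ultimately show ?L unfolding ang using a(1) k(2)[folded a_def] True by blast
    qed
    with True show ?thesis by simp
  qed
qed

theorem theorem3p11:
  fixes br :: "real^'d \<Rightarrow> real^'d \<Rightarrow> real^'m"
    and n :: nat
    and x1 :: "real^'d" and z1 :: "real^'m"
    and x :: "real \<Rightarrow> real^'d" and z :: "real \<Rightarrow> real^'m"
  assumes "CARD('d) = 2 * n"
    and "h_type_group br"
  shows
    "((\<exists>\<xi> \<eta>. hamilton_solution (hamiltonian br) x z \<xi> \<eta>)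
        \<and> x 0 = 0 \<and> z 0 = 0 \<and> x 1 = x1 \<and> z 1 = z1)
     \<longleftrightarrow>
     (z1 = 0 \<longrightarrow> (\<forall>t\<in>{0..1}. x t = t *\<^sub>R x1 \<and> z t = 0)) \<and>
     (z1 \<noteq> 0 \<longrightarrow>
       (\<exists>\<eta>\<^sub>0 \<xi>\<^sub>0.
          (\<forall>t\<in>{0..1}.
             x t = (1 / (norm \<eta>\<^sub>0)\<^sup>2) *\<^sub>R J br \<eta>\<^sub>0 (\<xi>\<^sub>0 - op_exp (\<lambda>v. t *\<^sub>R J br \<eta>\<^sub>0 v) \<xi>\<^sub>0) \<and>
             z t = ((norm \<xi>\<^sub>0)\<^sup>2 / (2 * (norm \<eta>\<^sub>0) ^ 3) * (norm \<eta>\<^sub>0 * t - sin (norm \<eta>\<^sub>0 * t))) *\<^sub>R \<eta>\<^sub>0) \<and>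
          (x1 \<noteq> 0 \<longrightarrow>
             (\<exists>\<theta>\<in>nu_domain.
                nu \<theta> = 4 * norm z1 / (norm x1)\<^sup>2 \<and>
                \<eta>\<^sub>0 = (2 * \<theta>) *\<^sub>R ((1 / norm z1) *\<^sub>R z1) \<and>
                \<xi>\<^sub>0 = - ((norm \<eta>\<^sub>0)\<^sup>2 *\<^sub>R inv (\<lambda>v. J br \<eta>\<^sub>0 (op_exp (J br \<eta>\<^sub>0) v - v)) x1))) \<and>
          (x1 = 0 \<longrightarrow>
             (\<exists>k::int. k \<ge> 1 \<and>
                \<eta>\<^sub>0 = (2 * pi * of_int k) *\<^sub>R ((1 / norm z1) *\<^sub>R z1) \<and>
                norm \<xi>\<^sub>0 = sqrt (4 * of_int k * pi * norm z1)))))"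
proof -
  note H = assms(2)
  \<comment> \<open>Evaluation at \<open>t = 1\<close> turns the endpoint conditions into conditions
    on the parameters \<eta> and \<xi>.\<close>
  have iff: "(\<exists>\<xi> \<eta>. hamilton_solution (hamiltonian br) x z \<xi> \<eta>) \<and> x 0 = 0 \<and> z 0 = 0 \<and> x 1 = x1 \<and> z 1 = z1
    \<longleftrightarrow> (\<exists>\<eta> \<xi>. (\<forall>t\<in>{0..1}. x t = geodesic_x br \<eta> \<xi> t \<and> z t = geodesic_z \<eta> \<xi> t) \<and>
          geodesic_x br \<eta> \<xi> 1 = x1 \<and> geodesic_z \<eta> \<xi> 1 = z1)" (is "?L \<longleftrightarrow> ?G")
    using hamilton_projection_iff[OF H, of x z] atLeastAtMost_iff[of 1 0 "1::real"]
    by (smt (verit, best))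
  show ?thesis
  proof (cases "z1 = 0")
    case True
    have "?G \<longleftrightarrow> (\<forall>t\<in>{0..1}. x t = t *\<^sub>R x1 \<and> z t = 0)"
    proof
      assume ?G
      then show "\<forall>t\<in>{0..1}. x t = t *\<^sub>R x1 \<and> z t = 0"
        using geodesic_endpoint_0[OF H] True by metis
    next
      assume "\<forall>t\<in>{0..1}. x t = t *\<^sub>R x1 \<and> z t = 0"
      \<comment> \<open>The straight line is the trajectory with \<eta> = 0 and initial velocity
        \<open>x1\<close>.\<close>
      then show ?G
        using True by (intro exI[of _ 0] exI[of _ x1]) (simp add: geodesic_eta_0[OF H])
    qed
    with iff True show ?thesis by simp
  next
    case False
    \<comment> \<open>The stated formulas divide by powers of |\<eta>|. A nonzero z(1) guarantees
      \<eta> \<noteq> 0, where they agree with the closed forms.\<close>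
    have form: "x t = (1 / (norm \<eta>)\<^sup>2) *\<^sub>R J br \<eta> (\<xi> - op_exp (\<lambda>v. t *\<^sub>R J br \<eta> v) \<xi>) \<and>
        z t = ((norm \<xi>)\<^sup>2 / (2 * (norm \<eta>) ^ 3) * (norm \<eta> * t - sin (norm \<eta> * t))) *\<^sub>R \<eta> \<longleftrightarrow>
        x t = geodesic_x br \<eta> \<xi> t \<and> z t = geodesic_z \<eta> \<xi> t"
      if "geodesic_z \<eta> \<xi> 1 = z1" for \<eta> \<xi> t
    proof -
      have "\<eta> \<noteq> 0" using that False by (auto simp: geodesic_z_def)
      then show ?thesis
        by (simp only: geodesic_x_eq_op_exp[OF H \<open>\<eta> \<noteq> 0\<close>] geodesic_z_eq[OF \<open>\<eta> \<noteq> 0\<close>])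
    qed
    have "(\<exists>\<eta> \<xi>. (\<forall>t\<in>{0..1}.
          x t = (1 / (norm \<eta>)\<^sup>2) *\<^sub>R J br \<eta> (\<xi> - op_exp (\<lambda>v. t *\<^sub>R J br \<eta> v) \<xi>) \<and>
          z t = ((norm \<xi>)\<^sup>2 / (2 * (norm \<eta>) ^ 3) * (norm \<eta> * t - sin (norm \<eta> * t))) *\<^sub>R \<eta>) \<and>
          geodesic_x br \<eta> \<xi> 1 = x1 \<and> geodesic_z \<eta> \<xi> 1 = z1) \<longleftrightarrow> ?G"
    proof (intro iff_exI)
      fix \<eta> \<xi>
      show "((\<forall>t\<in>{0..1}.
          x t = (1 / (norm \<eta>)\<^sup>2) *\<^sub>R J br \<eta> (\<xi> - op_exp (\<lambda>v. t *\<^sub>R J br \<eta> v) \<xi>) \<and>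
          z t = ((norm \<xi>)\<^sup>2 / (2 * (norm \<eta>) ^ 3) * (norm \<eta> * t - sin (norm \<eta> * t))) *\<^sub>R \<eta>) \<and>
          geodesic_x br \<eta> \<xi> 1 = x1 \<and> geodesic_z \<eta> \<xi> 1 = z1) \<longleftrightarrow>
        ((\<forall>t\<in>{0..1}. x t = geodesic_x br \<eta> \<xi> t \<and> z t = geodesic_z \<eta> \<xi> t) \<and>
          geodesic_x br \<eta> \<xi> 1 = x1 \<and> geodesic_z \<eta> \<xi> 1 = z1)"
      proof (cases "geodesic_z \<eta> \<xi> 1 = z1")
        case True
        show ?thesis by (simp only: form[OF True])
      qed simp
    qed
    with False show ?thesis
      unfolding iff geodesic_endpoint_iff[OF H False, symmetric] by simp
  qed
qed

end
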